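(* Let $\{\mathbf{x}^{k}\}_{k\ge 0}$ be a sequence generated by the CBCG method with the adaptive stepsize. Then for any $k\ge 0$, $$H(\mathbf{x}^{k})-H^{\ast}\le\frac{NC_2}{k+4}\qquad\text{and}\qquad \min_{n=0,1,\dots,k}S(\mathbf{x}^{n})\le\frac{2NC_2}{k+4},$$ where $$C_2=4\left[\max_{i=1,\dots,N}\max\left\{\beta_i\|\mathbf{A}_i\|^2D_i^2,\,K_i\right\}+\frac{NL_F^2D^2\max_{i=1,\dots,N}\|\mathbf{A}_i\|^2}{\beta_{\min}}\right].$$
   Context: Setting. $\|\cdot\|$ is the Euclidean norm for vectors and the spectral norm for matrices. A vector $\mathbf{x}\in\mathbb{R}^{d}$ is partitioned into $N$ blocks $\mathbf{x}=(\mathbf{x}_1,\dots,\mathbf{x}_N)$, $\mathbf{x}_i\in\mathbb{R}^{n_i}$, $\sum_i n_i=d$; $\mathbf{U}_i\in\mathbb{R}^{d\times n_i}$ is the submatrix of the identity consisting of the columns of block $i$, so $\mathbf{x}_i=\mathbf{U}_i^T\mathbf{x}$ and $\mathbf{x}=\sum_i\mathbf{U}_i\mathbf{x}_i$. Let $\mathbf{A}\in\mathbb{R}^{m\times d}$ and $\mathbf{A}_i=\mathbf{A}\mathbf{U}_i$. Assumptions: (1) each $g_i:\mathbb{R}^{n_i}\to(-\infty,\infty]$ is proper, closed and convex, its domain $X_i=\mathrm{dom}\,g_i$ is compact with diameter $D_i$, and $g_i$ is Lipschitz on $X_i$ with constant $l_i$. Put $X=X_1\times\cdots\times X_N$, with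 diameter $D$, $D^2=\sum_i D_i^2$. (2) $F:\mathbb{R}^m\to\mathbb{R}$ is convex and continuously differentiable over $\mathbf{A}(X)$ (i.e. continuously differentiable on an open set containing it), and $\nabla F$ is Lipschitz on $\mathbf{A}(X)$ with constant $L_F$. (3) For each $i$ there is a constant $\beta_i>0$ with $\|\nabla F(\mathbf{A}\mathbf{x}+\mathbf{A}_i\mathbf{h}_i)-\nabla F(\mathbf{A}\mathbf{x})\|\le\beta_i\|\mathbf{A}_i\mathbf{h}_i\|$ for all $\mathbf{x}\in X$, $\mathbf{h}_i\in\mathbb{R}^{n_i}$ with $\mathbf{x}+\mathbf{U}_i\mathbf{h}_i\in X$. Notation: $f(\mathbf{x})=F(\mathbf{A}\mathbf{x})$, $g(\mathbf{x})=\sum_i g_i(\mathbf{x}_i)$, $H=f+g$, $\nabla_i f(\mathbf{x})=\mathbf{U}_i^T\nabla f(\mathbf{x})=\mathbf{A}_i^T\nabla F(\mathbf{A}\mathbf{x})$, $H^{\ast}=\min H$ (attained). $\beta_{\min}=\min_i\beta_i$, $M_i=\max_{\mathbf{x}\in X}\|\nabla_i f(\mathbf{x})\|$, $K_i=(M_i+l_i)D_i$. Optimality measures: for $\mathbf{x}\in X$, $S(\mathbf{x})=\max_{\mathbf{p}\in X}\{\langle\nabla f(\mathbf{x}),\mathbf{x}-\mathbf{p}\rangle+g(\mathbf{x})-g(\mathbf{p})\}$ and $S_i(\mathbf{x})=\max_{\mathbf{p}_i\in X_i}\{\langle\nabla_i f(\mathbf{x}),\mathbf{x}_i-\mathbf{p}_i\rangle+g_i(\mathbf{x}_i)-g_i(\mathbf{p}_i)\}$.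 CBCG method: start from any $\mathbf{x}^0\in X$. For $k=0,1,2,\dots$: set $\mathbf{x}^{k,0}=\mathbf{x}^k$; for $i=1,\dots,N$ in order, choose $\mathbf{p}_i^k\in\mathrm{argmin}_{\mathbf{p}_i\in X_i}\{\langle\nabla_i f(\mathbf{x}^{k,i-1}),\mathbf{p}_i\rangle+g_i(\mathbf{p}_i)\}$ and set $\mathbf{x}^{k,i}=\mathbf{x}^{k,i-1}+\alpha_i^k\mathbf{U}_i(\mathbf{p}_i^k-\mathbf{x}_i^{k,i-1})$; then set $\mathbf{x}^{k+1}=\mathbf{x}^{k,N}$. Note $\mathbf{x}_i^{k,i-1}=\mathbf{x}_i^k$. Adaptive stepsize: $\alpha_i^k\in\mathrm{argmin}_{\alpha\in[0,1]}\{-\alpha S_i(\mathbf{x}^{k,i-1})+\alpha^2\frac{\beta_i}{2}\|\mathbf{A}_i(\mathbf{p}_i^k-\mathbf{x}_i^k)\|^2\}$, i.e. $\alpha_i^k=\min\left\{\frac{S_i(\mathbf{x}^{k,i-1})}{\beta_i\|\mathbf{A}_i(\mathbf{p}_i^k-\mathbf{x}_i^k)\|^2},1\right\}$ whenever the denominator is nonzero (if the minimizer is not unique, any minimizer may be taken). *)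

theory Defs
  imports "HOL-Analysis.Analysis"
begin

text \<open>
  A partition of the coordinates of \<open>real ^ 'd\<close> into blocks \<open>1, \<dots>, N\<close> is given by a labelling
  \<open>B :: 'd \<Rightarrow> nat\<close> with values in \<open>{1..N}\<close>; block \<open>i\<close> consists of the coordinates with label \<open>i\<close>,
  and \<open>n\<^sub>i\<close> is their number (possibly 0).  Since \<open>n\<^sub>i\<close> varies with \<open>i\<close>, the space of block-\<open>i\<close> vectors is not a
  separate type: it is identified, isometrically, with the subspace of \<open>real ^ 'd\<close> of vectors
  vanishing outside block \<open>i\<close>.  Accordingly \<open>U\<^sub>i\<close> is the identity matrix whose columns outside block
  \<open>i\<close> are replaced by zero columns rather than deleted; this changes neither the vector \<open>U\<^sub>i x\<^sub>i\<close>
  nor the spectral norm of \<open>A U\<^sub>i\<close>.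
\<close>

definition Umat :: "('d::finite \<Rightarrow> nat) \<Rightarrow> nat \<Rightarrow> real ^ 'd ^ 'd" where
  "Umat B i = (\<chi> r c. if r = c \<and> B c = i then 1 else 0)"

definition block_part :: "('d::finite \<Rightarrow> nat) \<Rightarrow> nat \<Rightarrow> real ^ 'd \<Rightarrow> real ^ 'd" where
  "block_part B i x = transpose (Umat B i) *v x"

definition block_space :: "('d::finite \<Rightarrow> nat) \<Rightarrow> nat \<Rightarrow> (real ^ 'd) set" where
  "block_space B i = range (block_part B i)"

definition block_mat :: "('d::finite \<Rightarrow> nat) \<Rightarrow> real ^ 'd ^ 'm::finite \<Rightarrow> nat \<Rightarrow> real ^ 'd ^ 'm" where
  "block_mat B A i = A ** Umat B i"

definition spectral_norm :: "real ^ 'n ^ 'm \<Rightarrow> real" where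
  "spectral_norm M = onorm (\<lambda>v. M *v v)"

text \<open>The gradient; meaningful only at points of differentiability.\<close>

definition grad :: "('a::real_inner \<Rightarrow> real) \<Rightarrow> 'a \<Rightarrow> 'a" where
  "grad f z = (THE D. GDERIV f z :> D)"

definition continuously_differentiable_over :: "('a::euclidean_space \<Rightarrow> real) \<Rightarrow> 'a set \<Rightarrow> bool" where
  "continuously_differentiable_over F S \<longleftrightarrow>
     (\<exists>T. open T \<and> S \<subseteq> T \<and> (\<forall>z\<in>T. F differentiable (at z)) \<and> continuous_on T (grad F))"

subsection \<open>Extended-valued functions on a subspace \<open>E\<close>\<close>

definition edom :: "'a set \<Rightarrow> ('a \<Rightarrow> ereal) \<Rightarrow> 'a set" where
  "edom E h = {v \<in> E. h v < \<infinity>}"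

definition eepigraph :: "'a set \<Rightarrow> ('a \<Rightarrow> ereal) \<Rightarrow> ('a \<times> real) set" where
  "eepigraph E h = {(v, t). v \<in> E \<and> h v \<le> ereal t}"

definition eproper :: "'a set \<Rightarrow> ('a \<Rightarrow> ereal) \<Rightarrow> bool" where
  "eproper E h \<longleftrightarrow> (\<forall>v\<in>E. h v \<noteq> -\<infinity>) \<and> edom E h \<noteq> {}"

definition eclosed :: "'a::euclidean_space set \<Rightarrow> ('a \<Rightarrow> ereal) \<Rightarrow> bool" where
  "eclosed E h \<longleftrightarrow> closed (eepigraph E h)"

definition econvex :: "'a::euclidean_space set \<Rightarrow> ('a \<Rightarrow> ereal) \<Rightarrow> bool" where
  "econvex E h \<longleftrightarrow> convex (eepigraph E h)"

subsection \<open>The composite problem\<close>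

text \<open>\<open>Xblk B g i\<close> is \<open>X\<^sub>i\<close>, \<open>Xset N B g\<close> is the product \<open>X\<close>.\<close>

definition Xblk :: "('d::finite \<Rightarrow> nat) \<Rightarrow> (nat \<Rightarrow> real ^ 'd \<Rightarrow> ereal) \<Rightarrow> nat \<Rightarrow> (real ^ 'd) set" where
  "Xblk B g i = edom (block_space B i) (g i)"

definition Xset :: "nat \<Rightarrow> ('d::finite \<Rightarrow> nat) \<Rightarrow> (nat \<Rightarrow> real ^ 'd \<Rightarrow> ereal) \<Rightarrow> (real ^ 'd) set" where
  "Xset N B g = {x. \<forall>i\<in>{1..N}. block_part B i x \<in> Xblk B g i}"

definition fobj :: "real ^ 'd ^ 'm \<Rightarrow> (real ^ 'm \<Rightarrow> real) \<Rightarrow> real ^ 'd \<Rightarrow> real" where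
  "fobj A F x = F (A *v x)"

definition grad_block ::
  "('d::finite \<Rightarrow> nat) \<Rightarrow> real ^ 'd ^ 'm::finite \<Rightarrow> (real ^ 'm \<Rightarrow> real) \<Rightarrow> nat \<Rightarrow> real ^ 'd \<Rightarrow> real ^ 'd" where
  "grad_block B A F i x = block_part B i (grad (fobj A F) x)"

definition gobj ::
  "nat \<Rightarrow> ('d::finite \<Rightarrow> nat) \<Rightarrow> (nat \<Rightarrow> real ^ 'd \<Rightarrow> ereal) \<Rightarrow> real ^ 'd \<Rightarrow> ereal" where
  "gobj N B g x = (\<Sum>i\<in>{1..N}. g i (block_part B i x))"

definition Hobj ::
  "nat \<Rightarrow> ('d::finite \<Rightarrow> nat) \<Rightarrow> real ^ 'd ^ 'm::finite \<Rightarrow> (real ^ 'm \<Rightarrow> real)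
    \<Rightarrow> (nat \<Rightarrow> real ^ 'd \<Rightarrow> ereal) \<Rightarrow> real ^ 'd \<Rightarrow> ereal" where
  "Hobj N B A F g x = ereal (fobj A F x) + gobj N B g x"

text \<open>
  Under the standing assumptions \<open>X\<close> is compact and all functions involved are continuous on it,
  so the infimum below and the suprema in \<open>Sgap\<close>, \<open>Sblk\<close> and \<open>Mblk\<close> are attained, i.e. they are
  the minimum of \<open>H\<close> and the maxima over \<open>X\<close> and \<open>X\<^sub>i\<close>.
\<close>

definition Hstar ::
  "nat \<Rightarrow> ('d::finite \<Rightarrow> nat) \<Rightarrow> real ^ 'd ^ 'm::finite \<Rightarrow> (real ^ 'm \<Rightarrow> real)
    \<Rightarrow> (nat \<Rightarrow> real ^ 'd \<Rightarrow> ereal) \<Rightarrow> ereal" where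
  "Hstar N B A F g = (INF x. Hobj N B A F g x)"

definition Sgap ::
  "nat \<Rightarrow> ('d::finite \<Rightarrow> nat) \<Rightarrow> real ^ 'd ^ 'm::finite \<Rightarrow> (real ^ 'm \<Rightarrow> real)
    \<Rightarrow> (nat \<Rightarrow> real ^ 'd \<Rightarrow> ereal) \<Rightarrow> real ^ 'd \<Rightarrow> real" where
  "Sgap N B A F g x = (SUP p\<in>Xset N B g. grad (fobj A F) x \<bullet> (x - p)
      + real_of_ereal (gobj N B g x) - real_of_ereal (gobj N B g p))"

definition Sblk ::
  "('d::finite \<Rightarrow> nat) \<Rightarrow> real ^ 'd ^ 'm::finite \<Rightarrow> (real ^ 'm \<Rightarrow> real)
    \<Rightarrow> (nat \<Rightarrow> real ^ 'd \<Rightarrow> ereal) \<Rightarrow> nat \<Rightarrow> real ^ 'd \<Rightarrow> real" where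
  "Sblk B A F g i x = (SUP p\<in>Xblk B g i. grad_block B A F i x \<bullet> (block_part B i x - p)
      + real_of_ereal (g i (block_part B i x)) - real_of_ereal (g i p))"

definition Mblk ::
  "nat \<Rightarrow> ('d::finite \<Rightarrow> nat) \<Rightarrow> real ^ 'd ^ 'm::finite \<Rightarrow> (real ^ 'm \<Rightarrow> real)
    \<Rightarrow> (nat \<Rightarrow> real ^ 'd \<Rightarrow> ereal) \<Rightarrow> nat \<Rightarrow> real" where
  "Mblk N B A F g i = (SUP x\<in>Xset N B g. norm (grad_block B A F i x))"

definition Kblk ::
  "nat \<Rightarrow> ('d::finite \<Rightarrow> nat) \<Rightarrow> real ^ 'd ^ 'm::finite \<Rightarrow> (real ^ 'm \<Rightarrow> real)
    \<Rightarrow> (nat \<Rightarrow> real ^ 'd \<Rightarrow> ereal) \<Rightarrow> (nat \<Rightarrow> real) \<Rightarrow> nat \<Rightarrow> real" where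
  "Kblk N B A F g l i = (Mblk N B A F g i + l i) * diameter (Xblk B g i)"

subsection \<open>The CBCG method\<close>

text \<open>
  \<open>x k\<close> is the outer iterate, \<open>y k i\<close> the inner iterate \<open>x\<^bsup>k,i\<^esup>\<close> (\<open>0 \<le> i \<le> N\<close>), \<open>p k i\<close> the chosen
  minimizer of the linearized block problem and \<open>\<alpha> k i\<close> the stepsize.
\<close>

definition cbcg_method ::
  "nat \<Rightarrow> ('d::finite \<Rightarrow> nat) \<Rightarrow> real ^ 'd ^ 'm::finite \<Rightarrow> (real ^ 'm \<Rightarrow> real)
    \<Rightarrow> (nat \<Rightarrow> real ^ 'd \<Rightarrow> ereal) \<Rightarrow> (nat \<Rightarrow> real ^ 'd) \<Rightarrow> (nat \<Rightarrow> nat \<Rightarrow> real ^ 'd)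
    \<Rightarrow> (nat \<Rightarrow> nat \<Rightarrow> real ^ 'd) \<Rightarrow> (nat \<Rightarrow> nat \<Rightarrow> real) \<Rightarrow> bool" where
  "cbcg_method N B A F g x y p \<alpha> \<longleftrightarrow>
     x 0 \<in> Xset N B g \<and>
     (\<forall>k. y k 0 = x k \<and>
        (\<forall>i\<in>{1..N}.
           is_arg_min (\<lambda>q. grad_block B A F i (y k (i - 1)) \<bullet> q + real_of_ereal (g i q))
             (\<lambda>q. q \<in> Xblk B g i) (p k i) \<and>
           y k i = y k (i - 1) + \<alpha> k i *\<^sub>R (p k i - block_part B i (y k (i - 1)))) \<and>
        x (Suc k) = y k N)"

definition adaptive_stepsize ::
  "nat \<Rightarrow> ('d::finite \<Rightarrow> nat) \<Rightarrow> real ^ 'd ^ 'm::finite \<Rightarrow> (real ^ 'm \<Rightarrow> real)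
    \<Rightarrow> (nat \<Rightarrow> real ^ 'd \<Rightarrow> ereal) \<Rightarrow> (nat \<Rightarrow> real) \<Rightarrow> (nat \<Rightarrow> real ^ 'd) \<Rightarrow> (nat \<Rightarrow> nat \<Rightarrow> real ^ 'd)
    \<Rightarrow> (nat \<Rightarrow> nat \<Rightarrow> real ^ 'd) \<Rightarrow> (nat \<Rightarrow> nat \<Rightarrow> real) \<Rightarrow> bool" where
  "adaptive_stepsize N B A F g \<beta> x y p \<alpha> \<longleftrightarrow>
     (\<forall>k. \<forall>i\<in>{1..N}.
        is_arg_min (\<lambda>a. - a * Sblk B A F g i (y k (i - 1))
            + a\<^sup>2 * (\<beta> i / 2) * (norm (block_mat B A i *v (p k i - block_part B i (x k))))\<^sup>2)
          (\<lambda>a. a \<in> {0..1}) (\<alpha> k i))"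

definition C2const ::
  "nat \<Rightarrow> ('d::finite \<Rightarrow> nat) \<Rightarrow> real ^ 'd ^ 'm::finite \<Rightarrow> (real ^ 'm \<Rightarrow> real)
    \<Rightarrow> (nat \<Rightarrow> real ^ 'd \<Rightarrow> ereal) \<Rightarrow> (nat \<Rightarrow> real) \<Rightarrow> real \<Rightarrow> (nat \<Rightarrow> real) \<Rightarrow> real" where
  "C2const N B A F g l LF \<beta> =
     4 * ((MAX i\<in>{1..N}. max (\<beta> i * (spectral_norm (block_mat B A i))\<^sup>2 * (diameter (Xblk B g i))\<^sup>2)
                              (Kblk N B A F g l i))
          + real N * LF\<^sup>2 * (diameter (Xset N B g))\<^sup>2
              * (MAX i\<in>{1..N}. (spectral_norm (block_mat B A i))\<^sup>2) / (MIN i\<in>{1..N}. \<beta> i))"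

end

theory Submission
  imports Defs
begin

text \<open>
  Block step \<open>i\<close> of cycle \<open>k\<close> decreases \<open>H\<close> by at least some \<open>e\<^sub>i\<close> with
  \<open>S\<^sub>i\<^sup>2 \<le> 2 C\<^sub>1 e\<^sub>i\<close> and \<open>\<beta>\<^sub>m\<^sub>i\<^sub>n \<parallel>A (x\<^bsup>k,i\<^esup> - x\<^bsup>k,i-1\<^esup>)\<parallel>\<^sup>2 \<le> 2 e\<^sub>i\<close>, where \<open>S\<^sub>i\<close> is
  the block gap at \<open>x\<^bsup>k,i-1\<^esup>\<close> and \<open>C\<^sub>1\<close> is the first summand of \<open>C\<^sub>2 / 4\<close>. The gap \<open>S(x\<^sup>k)\<close> exceeds the sum of
  the \<open>S\<^sub>i\<close> only by gradient differences between \<open>x\<^sup>k\<close> and \<open>x\<^bsup>k,i-1\<^esup>\<close>, which the same \<open>e\<^sub>j\<close> control. With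
  \<open>\<gamma> = N C\<^sub>2\<close> this yields \<open>S(x\<^sup>k)\<^sup>2 \<le> \<gamma> (H(x\<^sup>k) - H(x\<^bsup>k+1\<^esup>))\<close>, while convexity gives
  \<open>H(x\<^sup>k) - H(z) \<le> S(x\<^sup>k)\<close> for \<open>z \<in> X\<close> and the definition of \<open>K\<^sub>i\<close> gives \<open>S(x\<^sup>0) \<le> \<gamma> / 4\<close>. Both rates follow from these
  three scalar inequalities.
\<close>

subsection \<open>Gradients and convexity\<close>

text \<open>\<open>grad\<close> is a definite description, so existence and uniqueness are both due.
  The candidate is \<open>adjoint f' 1\<close>, the vector that represents the derivative
  \<open>f'\<close> through the inner product.\<close>

lemma GDERIV_grad:
  fixes f :: "'a::euclidean_space \<Rightarrow> real"
  assumes "f differentiable (at z)"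
  shows "GDERIV f z :> grad f z"
proof -
  obtain f' where f': "(f has_derivative f') (at z)"
    using assms by (auto simp: differentiable_def)
  then interpret bounded_linear f' by (rule has_derivative_bounded_linear)
  have "f' = (\<lambda>h. h \<bullet> adjoint f' 1)"
    using adjoint_works[OF linear_axioms, of _ 1] by (intro ext) simp
  with f' have D: "GDERIV f z :> adjoint f' 1" unfolding gderiv_def by metis
  have "D = adjoint f' 1" if "GDERIV f z :> D" for D
  proof -
    have "(\<lambda>h. h \<bullet> D) = (\<lambda>h. h \<bullet> adjoint f' 1)"
      using that D unfolding gderiv_def by (rule has_derivative_unique)
    then show ?thesis by (metis vector_eq_ldot)
  qed
  with D show ?thesis unfolding grad_def by (rule theI)
qed

lemma GDERIV_imp_grad_eq:
  fixes f :: "'a::euclidean_space \<Rightarrow> real"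
  assumes "GDERIV f z :> D"
  shows "grad f z = D"
proof -
  have "(\<lambda>h. h \<bullet> grad f z) = (\<lambda>h. h \<bullet> D)"
    using GDERIV_grad[of f z] assms unfolding gderiv_def
    by (metis differentiableI has_derivative_unique)
  then show ?thesis by (metis vector_eq_ldot)
qed

lemma GDERIV_line:
  assumes "GDERIV f (u + t *\<^sub>R v) :> D"
  shows "((\<lambda>t. f (u + t *\<^sub>R v)) has_real_derivative v \<bullet> D) (at t)"
proof -
  have "((\<lambda>t. u + t *\<^sub>R v) has_derivative (\<lambda>s. s *\<^sub>R v)) (at t)"
    by (auto intro!: derivative_eq_intros)
  from has_derivative_compose[OF this assms[unfolded gderiv_def]] show ?thesis
    by (simp add: has_field_derivative_def mult_commute_abs)
qed

text \<open>Otherwise \<open>f\<close> minus its chord from \<open>u\<close> to \<open>v\<close>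
  would have positive slope at \<open>u\<close>, and \<open>f\<close> would exceed the chord shortly
  after \<open>u\<close>. The argument stays on the segment, so \<open>S\<close> may have empty
  interior, as the image of \<open>X\<close> under \<open>A\<close> may.\<close>

lemma convex_on_above_tangent:
  assumes cvx: "convex_on S f" and u: "u \<in> S" and v: "v \<in> S"
    and D: "GDERIV f u :> D"
  shows "f u + D \<bullet> (v - u) \<le> f v"
proof (rule ccontr)
  assume "\<not> ?thesis"
  then have pos: "0 < (v - u) \<bullet> D - (f v - f u)" by (simp add: inner_commute)
  define \<psi> where "\<psi> t = f (u + t *\<^sub>R (v - u)) - t * (f v - f u)" for t
  have "(\<psi> has_real_derivative (v - u) \<bullet> D - (f v - f u)) (at 0)"
    unfolding \<psi>_def using GDERIV_line[of f u 0 "v - u" D] D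
    by (auto intro!: derivative_eq_intros)
  from DERIV_pos_inc_right[OF this pos]
  obtain d where d: "d > 0" "\<And>h. 0 < h \<Longrightarrow> h < d \<Longrightarrow> \<psi> 0 < \<psi> h" by auto
  define h where "h = min (d / 2) 1"
  have h: "0 < h" "h < d" "h \<le> 1" using d(1) by (auto simp: h_def)
  have "f ((1 - h) *\<^sub>R u + h *\<^sub>R v) \<le> (1 - h) * f u + h * f v"
    using convex_onD[OF cvx, of h u v] h u v by simp
  moreover have "(1 - h) *\<^sub>R u + h *\<^sub>R v = u + h *\<^sub>R (v - u)"
    by (simp add: algebra_simps)
  ultimately have "\<psi> h \<le> \<psi> 0" by (simp add: \<psi>_def algebra_simps)
  with d(2)[OF h(1,2)] show False by simp
qed

text \<open>Subtracting the tangent and the quadratic term leaves a function of \<open>t\<close>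
  with nonpositive derivative on \<open>[0, 1]\<close>. The Lipschitz bound compares with the base
  point \<open>u\<close> only, the form in which the constants \<open>\<beta> i\<close> are
  given.\<close>

lemma descent_along_segment:
  assumes diff: "\<And>t. 0 \<le> t \<Longrightarrow> t \<le> 1 \<Longrightarrow> GDERIV f (u + t *\<^sub>R v) :> G (u + t *\<^sub>R v)"
    and lip: "\<And>t. 0 \<le> t \<Longrightarrow> t \<le> 1 \<Longrightarrow> norm (G (u + t *\<^sub>R v) - G u) \<le> b * norm (t *\<^sub>R v)"
  shows "f (u + v) \<le> f u + G u \<bullet> v + b / 2 * (norm v)\<^sup>2"
proof -
  define \<psi> where "\<psi> t = f (u + t *\<^sub>R v) - t * (G u \<bullet> v) - b / 2 * (norm v)\<^sup>2 * t\<^sup>2" for t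
  have "\<psi> 1 \<le> \<psi> 0"
  proof (rule DERIV_nonpos_imp_nonincreasing[of 0 1 \<psi>])
    fix t :: real assume t: "0 \<le> t" "t \<le> 1"
    have "(\<psi> has_real_derivative v \<bullet> G (u + t *\<^sub>R v) - G u \<bullet> v - b * (norm v)\<^sup>2 * t) (at t)"
      unfolding \<psi>_def by (auto intro!: derivative_eq_intros GDERIV_line diff t)
    moreover have "v \<bullet> G (u + t *\<^sub>R v) - G u \<bullet> v \<le> b * (norm v)\<^sup>2 * t"
    proof -
      have "v \<bullet> G (u + t *\<^sub>R v) - G u \<bullet> v = (G (u + t *\<^sub>R v) - G u) \<bullet> v"
        by (simp add: inner_diff_left inner_commute[of v])
      also have "\<dots> \<le> norm (G (u + t *\<^sub>R v) - G u) * norm v" by (rule norm_cauchy_schwarz)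
      also have "\<dots> \<le> b * norm (t *\<^sub>R v) * norm v" by (intro mult_right_mono lip t) simp
      finally show ?thesis using t by (simp add: power2_eq_square mult_ac)
    qed
    ultimately show "\<exists>y. (\<psi> has_real_derivative y) (at t) \<and> y \<le> 0" by force
  qed simp
  then show ?thesis by (simp add: \<psi>_def)
qed

subsection \<open>Scalar sequences and the stepsize model\<close>

text \<open>\<open>a * S - a\<^sup>2 * b\<close> is the decrease promised by the model at its
  minimizer \<open>a\<close>. The second claim holds because the minimizer never lies beyond the
  vertex of the parabola; the third compares \<open>a\<close> with the trial step
  \<open>S / C\<close>.\<close>

lemma quadratic_argmin:
  fixes S b :: real
  assumes min: "is_arg_min (\<lambda>a. - a * S + a\<^sup>2 * b) (\<lambda>a. a \<in> {0..1}) a"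
    and S: "0 \<le> S" and b: "0 \<le> b"
  shows "0 \<le> a * S - a\<^sup>2 * b"
    and "a\<^sup>2 * b \<le> a * S - a\<^sup>2 * b"
    and "2 * b \<le> C \<Longrightarrow> S \<le> C \<Longrightarrow> S\<^sup>2 \<le> 2 * C * (a * S - a\<^sup>2 * b)"
proof -
  have a: "0 \<le> a" "a \<le> 1" using min by (auto simp: is_arg_min_def)
  have opt: "c * S - c\<^sup>2 * b \<le> a * S - a\<^sup>2 * b" if "0 \<le> c" "c \<le> 1" for c
    using min that by (force simp: is_arg_min_def not_less)
  show nonneg: "0 \<le> a * S - a\<^sup>2 * b" using opt[of 0] by simp
  show "a\<^sup>2 * b \<le> a * S - a\<^sup>2 * b"
  proof (rule ccontr)
    assume "\<not> ?thesis"
    then have lt: "a * S < a * (2 * a * b)" by (simp add: power2_eq_square algebra_simps)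
    then have Sb: "S < 2 * a * b" using a by (simp add: mult_less_cancel_left)
    then have "0 < a * b" using S by linarith
    then have "0 < b" using a b by (simp add: zero_less_mult_iff)
    \<comment> \<open>The vertex of the parabola would lie in \<open>[0, a)\<close>, hence be
      admissible, and beat \<open>a\<close> by \<open>b * (a - c)\<^sup>2\<close>.\<close>
    define c where "c = S / (2 * b)"
    have c: "0 \<le> c" "c < a" using Sb S \<open>0 < b\<close> by (auto simp: c_def field_simps)
    have Sc: "S = 2 * b * c" using \<open>0 < b\<close> by (simp add: c_def)
    have "0 < b * (a - c)\<^sup>2" using c \<open>0 < b\<close> by simp
    moreover have "c * S - c\<^sup>2 * b \<le> a * S - a\<^sup>2 * b" using opt[of c] c a by simp
    ultimately show False unfolding Sc by (simp add: power2_eq_square algebra_simps)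
  qed
  show "S\<^sup>2 \<le> 2 * C * (a * S - a\<^sup>2 * b)" if C: "2 * b \<le> C" "S \<le> C"
  proof (cases "C = 0")
    case True
    with C S show ?thesis by simp
  next
    case False
    then have "C > 0" using C b by linarith
    \<comment> \<open>The trial step \<open>S / C\<close> lies in \<open>[0, 1]\<close> as
      \<open>S \<le> C\<close>, and \<open>2 * b \<le> C\<close> makes its decrease at least
      \<open>S\<^sup>2 / (2 * C)\<close>.\<close>
    have "S\<^sup>2 * (2 * b) \<le> S\<^sup>2 * C" using C by (intro mult_left_mono) auto
    then have "S\<^sup>2 / 2 \<le> C * (S / C * S - (S / C)\<^sup>2 * b)"
      using \<open>C > 0\<close> by (simp add: field_simps power2_eq_square)
    also have "\<dots> \<le> C * (a * S - a\<^sup>2 * b)"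
      using opt[of "S / C"] \<open>C > 0\<close> C S by (intro mult_left_mono) auto
    finally show ?thesis by simp
  qed
qed

text \<open>For positive \<open>a n\<close> and \<open>\<gamma>\<close> the recurrence reads
  \<open>a (Suc n) \<le> a n - (a n)\<^sup>2 / \<gamma>\<close>. The right side increases in
  \<open>a n\<close> up to \<open>\<gamma> / 2\<close>, so the inductive bound may be inserted for
  \<open>a n\<close>. Once a term is nonpositive, monotonicity settles the next one.\<close>

lemma harmonic_decay:
  fixes a :: "nat \<Rightarrow> real"
  assumes start: "a 0 \<le> \<gamma> / 4"
    and dec: "\<And>n. a (Suc n) \<le> a n"
    and quad: "\<And>n. 0 \<le> a n \<Longrightarrow> (a n)\<^sup>2 \<le> \<gamma> * (a n - a (Suc n))"
    and \<gamma>: "0 \<le> \<gamma>"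
  shows "a n \<le> \<gamma> / (real n + 4)"
proof (induction n)
  case 0
  with start show ?case by simp
next
  case (Suc n)
  show ?case
  proof (cases "a n \<le> 0 \<or> \<gamma> = 0")
    case True
    then have "a n \<le> 0" using Suc by auto
    then have "a (Suc n) \<le> 0" using dec[of n] by linarith
    also have "0 \<le> \<gamma> / (real (Suc n) + 4)" using \<gamma> by simp
    finally show ?thesis .
  next
    case False
    then have pos: "0 < a n" "0 < \<gamma>" using \<gamma> by auto
    define r where "r = real n + 4"
    define c where "c = \<gamma> / r"
    have r: "4 \<le> r" by (simp add: r_def)
    have "c \<le> \<gamma> / 2" unfolding c_def using pos r by (intro divide_left_mono) auto
    moreover have "a n \<le> c" using Suc by (simp add: c_def r_def)
    \<comment> \<open>The product equals \<open>(\<gamma> * c - c\<^sup>2) - (\<gamma> * a n - (a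
      n)\<^sup>2)\<close>, so this is the monotonicity of the recurrence map below
      \<open>\<gamma> / 2\<close>.\<close>
    ultimately have "0 \<le> (c - a n) * (\<gamma> - c - a n)"
      by (intro mult_nonneg_nonneg) auto
    then have "\<gamma> * a (Suc n) \<le> \<gamma> * c - c\<^sup>2"
      using quad[of n] pos by (simp add: power2_eq_square algebra_simps)
    also have "\<dots> = \<gamma>\<^sup>2 * ((r - 1) / r\<^sup>2)"
      unfolding c_def using r by (simp add: field_simps power2_eq_square)
    also have "\<dots> \<le> \<gamma>\<^sup>2 * (1 / (r + 1))"
    proof (intro mult_left_mono)
      have "(r - 1) * (r + 1) \<le> r\<^sup>2" by (simp add: power2_eq_square algebra_simps)
      then show "(r - 1) / r\<^sup>2 \<le> 1 / (r + 1)" using r by (simp add: divide_simps)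
    qed simp
    also have "\<dots> = \<gamma> * (\<gamma> / (real (Suc n) + 4))" by (simp add: r_def power2_eq_square)
    finally show ?thesis using pos(2) by (rule mult_left_le_imp_le)
  qed
qed

text \<open>The best value is found in the window \<open>{j..k}\<close> of about \<open>k / 2\<close> last steps, over which the
  sum of the \<open>(S n)\<^sup>2\<close> telescopes.\<close>

lemma harmonic_decay_min:
  fixes S H :: "nat \<Rightarrow> real"
  assumes S0: "S 0 \<le> \<gamma> / 4"
    and S_nonneg: "\<And>n. 0 \<le> S n"
    and quad: "\<And>n. (S n)\<^sup>2 \<le> \<gamma> * (H n - H (Suc n))"
    and decay: "\<And>j k. j \<le> k \<Longrightarrow> H j - H k \<le> \<gamma> / (real j + 4)"
    and \<gamma>: "0 \<le> \<gamma>"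
  shows "(MIN n\<in>{0..k}. S n) \<le> 2 * \<gamma> / (real k + 4)"
proof (cases "k \<le> 4")
  case True
  \<comment> \<open>Short runs are settled by \<open>S 0\<close> alone, as
    \<open>k + 4 \<le> 8\<close>.\<close>
  have "(MIN n\<in>{0..k}. S n) \<le> S 0" by (intro Min_le) auto
  also have "\<dots> \<le> 2 * \<gamma> / 8" using S0 by simp
  also have "\<dots> \<le> 2 * \<gamma> / (real k + 4)" using True \<gamma> by (intro divide_left_mono) auto
  finally show ?thesis .
next
  case False
  \<comment> \<open>For \<open>k > 4\<close> the subtraction does not truncate. This start nearly
    balances the window length \<open>Suc k - j\<close> against the factor \<open>j + 4\<close> from
    \<open>decay\<close>; the two add up to \<open>k + 5\<close>.\<close>
  define j where "j = k div 2 - 2"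
  define m where "m = (MIN n\<in>{0..k}. S n)"
  have "m \<in> S ` {0..k}" unfolding m_def by (rule Min_in) auto
  then have m0: "0 \<le> m" using S_nonneg by auto
  have jk: "j \<le> k" by (simp add: j_def)
  have "real (Suc k - j) * m\<^sup>2 = (\<Sum>n\<in>{j..k}. m\<^sup>2)" by simp
  also have "\<dots> \<le> (\<Sum>n\<in>{j..k}. \<gamma> * (H n - H (Suc n)))"
  proof (rule sum_mono)
    fix n assume "n \<in> {j..k}"
    then have "m \<le> S n" unfolding m_def by (intro Min_le) auto
    then have "m\<^sup>2 \<le> (S n)\<^sup>2" using m0 by (rule power_mono)
    with quad[of n] show "m\<^sup>2 \<le> \<gamma> * (H n - H (Suc n))" by linarith
  qed
  also have "\<dots> = \<gamma> * (H j - H (Suc k))"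
    using sum_Suc_diff[of j "Suc k" "\<lambda>n. - H n"] jk
    by (simp add: sum_distrib_left[symmetric] atLeastLessThanSuc_atLeastAtMost)
  also have "\<dots> \<le> \<gamma> * (\<gamma> / (real j + 4))" using decay[of j "Suc k"] jk \<gamma> by (intro mult_left_mono) auto
  finally have win: "real (Suc k - j) * (real j + 4) * m\<^sup>2 \<le> \<gamma>\<^sup>2"
    by (simp add: field_simps power2_eq_square)
  have "(k + 4)\<^sup>2 \<le> 4 * ((Suc k - j) * (j + 4))"
  proof -
    have "k = 2 * (k div 2) \<or> k = 2 * (k div 2) + 1" by linarith
    moreover have "k div 2 = j + 2" using False by (auto simp: j_def)
    ultimately have "k = 2 * j + 4 \<or> k = 2 * j + 5" by linarith
    then show ?thesis by (auto simp: power2_eq_square algebra_simps)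
  qed
  then have "real ((k + 4)\<^sup>2) \<le> real (4 * ((Suc k - j) * (j + 4)))" by (rule of_nat_mono)
  then have "(real k + 4)\<^sup>2 \<le> 4 * (real (Suc k - j) * (real j + 4))" by simp
  then have "(real k + 4)\<^sup>2 * m\<^sup>2 \<le> 4 * (real (Suc k - j) * (real j + 4)) * m\<^sup>2"
    by (rule mult_right_mono) simp
  also have "\<dots> \<le> (2 * \<gamma>)\<^sup>2" using win by simp
  finally have "((real k + 4) * m)\<^sup>2 \<le> (2 * \<gamma>)\<^sup>2" by (simp add: power_mult_distrib)
  then have "(real k + 4) * m \<le> 2 * \<gamma>" by (rule power2_le_imp_le) (use \<gamma> in simp)
  then show ?thesis unfolding m_def[symmetric] by (simp add: pos_le_divide_eq mult.commute)
qed

subsection \<open>Blocks and the composite problem\<close>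

lemma block_part_nth: "block_part B i z $ c = (if B c = i then z $ c else 0)"
proof -
  have "(\<Sum>j\<in>UNIV. (if j = c \<and> B c = i then 1 else 0) * z $ j)
      = (\<Sum>j\<in>UNIV. if j = c then (if B c = i then z $ j else 0) else 0)"
    by (rule sum.cong) auto
  then show ?thesis
    by (simp add: block_part_def Umat_def matrix_vector_mult_def transpose_def)
qed

text \<open>With its zero columns kept, \<open>Umat B i\<close> is a symmetric coordinate
  projection, so lifting a block and extracting it are the same map.\<close>

lemma Umat_mult: "Umat B i *v z = block_part B i z"
proof -
  have "transpose (Umat B i) = Umat B i"
    by (auto simp: Umat_def transpose_def vec_eq_iff)
  then show ?thesis by (simp add: block_part_def)
qed

lemma block_mat_mult: "block_mat B A i *v z = A *v block_part B i z"
  by (simp add: block_mat_def Umat_mult flip: matrix_vector_mul_assoc)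

lemma linear_block_part: "linear (block_part B i)"
  by (rule linearI) (simp_all add: vec_eq_iff block_part_nth)

lemmas block_part_add = linear_add[OF linear_block_part]
lemmas block_part_diff = linear_diff[OF linear_block_part]
lemmas block_part_scaleR = linear_cmul[OF linear_block_part]

lemma block_part_block_part:
  "block_part B i (block_part B j z) = (if i = j then block_part B i z else 0)"
  by (auto simp: vec_eq_iff block_part_nth)

lemma block_part_in_space [simp]: "block_part B i z \<in> block_space B i"
  by (simp add: block_space_def)

lemma block_part_of_block_space:
  "h \<in> block_space B j \<Longrightarrow> block_part B i h = (if i = j then h else 0)"
  by (auto simp: block_space_def block_part_block_part)

lemma subspace_block_space: "subspace (block_space B i)"
  unfolding block_space_def
  by (rule linear_subspace_image[OF linear_block_part subspace_UNIV])

lemma block_part_inner: "block_part B i u \<bullet> v = u \<bullet> block_part B i v"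
  unfolding inner_vec_def by (rule sum.cong) (auto simp: block_part_nth)

lemma norm_block_part_le: "norm (block_part B i z) \<le> norm z"
  by (rule norm_le_componentwise_cart) (simp add: block_part_nth)

locale block_partition =
  fixes N :: nat and B :: "'d::finite \<Rightarrow> nat"
  assumes blocks: "range B \<subseteq> {1..N}"
begin

text \<open>A coordinate type is never empty, so some label occurs; the maxima and minima over
  \<open>{1..N}\<close> are thus over a nonempty set.\<close>

lemma N_pos: "0 < N"
proof -
  have "B undefined \<in> {1..N}" using blocks by blast
  then show ?thesis by auto
qed

lemma sum_block_part: "(\<Sum>i\<in>{1..N}. block_part B i z) = z"
proof -
  have "B c \<in> {1..N}" for c using blocks by blast
  then show ?thesis by (simp add: vec_eq_iff block_part_nth)
qed

lemma sum_norm_block_part: "(\<Sum>i\<in>{1..N}. (norm (block_part B i z))\<^sup>2) = (norm z)\<^sup>2"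
proof -
  have "(norm (block_part B i z))\<^sup>2 = block_part B i z \<bullet> z" for i
    by (simp add: power2_norm_eq_inner block_part_inner block_part_block_part)
  then have "(\<Sum>i\<in>{1..N}. (norm (block_part B i z))\<^sup>2) = (\<Sum>i\<in>{1..N}. block_part B i z) \<bullet> z"
    by (simp add: inner_sum_left)
  then show ?thesis by (simp only: sum_block_part power2_norm_eq_inner)
qed

end

lemma norm_block_mat_le:
  assumes "h \<in> block_space B i"
  shows "norm (A *v h) \<le> spectral_norm (block_mat B A i) * norm h"
proof -
  have "A *v h = block_mat B A i *v h"
    using assms by (simp add: block_mat_mult block_part_of_block_space)
  then show ?thesis unfolding spectral_norm_def
    using onorm[OF matrix_vector_mul_bounded_linear, of "block_mat B A i" h] by simp
qed

section \<open>Standing assumptions and the real-valued form of the problem\<close>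

locale composite_problem = block_partition N B
  for N :: nat and B :: "'d::finite \<Rightarrow> nat" +
  fixes A :: "real ^ 'd ^ 'm::finite"
    and F :: "real ^ 'm \<Rightarrow> real"
    and g :: "nat \<Rightarrow> real ^ 'd \<Rightarrow> ereal"
    and l \<beta> :: "nat \<Rightarrow> real"
    and LF :: real
  assumes g_proper: "\<And>i. i \<in> {1..N} \<Longrightarrow> eproper (block_space B i) (g i)"
    and g_convex: "\<And>i. i \<in> {1..N} \<Longrightarrow> econvex (block_space B i) (g i)"
    and X_compact: "\<And>i. i \<in> {1..N} \<Longrightarrow> compact (Xblk B g i)"
    and g_lipschitz: "\<And>i. i \<in> {1..N} \<Longrightarrow>
          (l i)-lipschitz_on (Xblk B g i) (\<lambda>v. real_of_ereal (g i v))"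
    and F_convex: "convex_on ((\<lambda>z. A *v z) ` Xset N B g) F"
    and F_C1: "continuously_differentiable_over F ((\<lambda>z. A *v z) ` Xset N B g)"
    and F_lipschitz: "LF-lipschitz_on ((\<lambda>z. A *v z) ` Xset N B g) (grad F)"
    and \<beta>_pos: "\<And>i. i \<in> {1..N} \<Longrightarrow> \<beta> i > 0"
    and \<beta>_lipschitz: "\<And>i z h. i \<in> {1..N} \<Longrightarrow> z \<in> Xset N B g \<Longrightarrow> h \<in> block_space B i \<Longrightarrow>
          z + Umat B i *v h \<in> Xset N B g \<Longrightarrow>
          norm (grad F (A *v z + block_mat B A i *v h) - grad F (A *v z))
            \<le> \<beta> i * norm (block_mat B A i *v h)"
begin

abbreviation "X \<equiv> Xset N B g"
abbreviation "Xi \<equiv> Xblk B g"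
abbreviation "bp \<equiv> block_part B"
abbreviation "gr i v \<equiv> real_of_ereal (g i v)"
abbreviation "dF z \<equiv> grad F (A *v z)"
abbreviation "snorm i \<equiv> spectral_norm (block_mat B A i)"

text \<open>Real form of \<open>H\<close>, meant for points of \<open>X\<close>, where every
  \<open>g i\<close> is finite; it keeps the estimates free of extended arithmetic.\<close>

definition Hreal :: "real ^ 'd \<Rightarrow> real" where
  "Hreal z = F (A *v z) + (\<Sum>i\<in>{1..N}. gr i (bp i z))"

text \<open>The expression maximized in \<open>S\<^sub>i\<close>, with the competitor
  \<open>q\<close> left free and the gradient term pulled through \<open>A\<close> so that no
  transpose appears.\<close>

definition bgap :: "nat \<Rightarrow> real ^ 'd \<Rightarrow> real ^ 'd \<Rightarrow> real" where
  "bgap i z q = dF z \<bullet> (A *v (bp i z - q)) + gr i (bp i z) - gr i q"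

lemma in_X: "z \<in> X \<longleftrightarrow> (\<forall>i\<in>{1..N}. bp i z \<in> Xi i)"
  by (simp add: Xset_def)

lemma Xi_block_space: "v \<in> Xi i \<Longrightarrow> v \<in> block_space B i"
  by (simp add: Xblk_def edom_def)

lemma ereal_gr:
  assumes "i \<in> {1..N}" "v \<in> Xi i"
  shows "ereal (gr i v) = g i v"
  using g_proper[OF assms(1)] assms(2)
  by (auto simp: Xblk_def edom_def eproper_def ereal_real)

text \<open>The epigraph point between \<open>(u, gr i u)\<close> and \<open>(v, gr i v)\<close>
  yields both claims: a real upper bound on \<open>g i\<close> there also places the point in the
  domain.\<close>

lemma Xi_convex_comb:
  assumes i: "i \<in> {1..N}" and u: "u \<in> Xi i" and v: "v \<in> Xi i" and a: "0 \<le> a" "a \<le> 1"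
  shows "u + a *\<^sub>R (v - u) \<in> Xi i"
    and "gr i (u + a *\<^sub>R (v - u)) \<le> gr i u + a * (gr i v - gr i u)"
proof -
  let ?w = "u + a *\<^sub>R (v - u)"
  let ?E = "eepigraph (block_space B i) (g i)"
  have epi: "(w, gr i w) \<in> ?E" if "w \<in> Xi i" for w
    using that by (simp add: eepigraph_def Xi_block_space ereal_gr[OF i])
  have "(1 - a) *\<^sub>R (u, gr i u) + a *\<^sub>R (v, gr i v) \<in> ?E"
    using g_convex[OF i] a unfolding econvex_def by (intro convexD epi u v) auto
  moreover have "(1 - a) *\<^sub>R (u, gr i u) + a *\<^sub>R (v, gr i v) = (?w, gr i u + a * (gr i v - gr i u))"
    by (simp add: algebra_simps)
  ultimately have w: "?w \<in> block_space B i" "g i ?w \<le> ereal (gr i u + a * (gr i v - gr i u))"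
    by (auto simp: eepigraph_def)
  from w(2) have "g i ?w < \<infinity>" by (rule le_less_trans) simp
  with w(1) show "?w \<in> Xi i" by (simp add: Xblk_def edom_def)
  from ereal_gr[OF i this] w(2) show "gr i ?w \<le> gr i u + a * (gr i v - gr i u)"
    by (metis ereal_less_eq(3))
qed

lemma block_part_update:
  assumes "q \<in> block_space B i"
  shows "bp j (z + a *\<^sub>R (q - bp i z)) = (if j = i then bp i z + a *\<^sub>R (q - bp i z) else bp j z)"
  using assms
  by (simp add: block_part_add block_part_scaleR block_part_diff block_part_block_part
      block_part_of_block_space)

lemma update_in_X:
  assumes i: "i \<in> {1..N}" and z: "z \<in> X" and q: "q \<in> Xi i" and a: "0 \<le> a" "a \<le> 1"
  shows "z + a *\<^sub>R (q - bp i z) \<in> X"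
proof -
  have "bp i z + a *\<^sub>R (q - bp i z) \<in> Xi i"
    using Xi_convex_comb(1)[OF i _ q a] i z by (simp add: in_X)
  then show ?thesis
    using z by (simp add: in_X block_part_update[OF Xi_block_space[OF q]])
qed

lemma GDERIV_F: "z \<in> X \<Longrightarrow> GDERIV F (A *v z) :> dF z"
  using F_C1 by (auto simp: continuously_differentiable_over_def intro!: GDERIV_grad)

lemma grad_fobj:
  assumes "z \<in> X"
  shows "grad (fobj A F) z = transpose A *v dF z"
proof (rule GDERIV_imp_grad_eq)
  have "((\<lambda>z. A *v z) has_derivative (\<lambda>h. A *v h)) (at z)"
    by (rule bounded_linear_imp_has_derivative) (rule matrix_vector_mul_bounded_linear)
  from has_derivative_compose[OF this GDERIV_F[OF assms, unfolded gderiv_def]]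
  show "GDERIV (fobj A F) z :> transpose A *v dF z"
    by (simp add: gderiv_def fobj_def[abs_def] inner_commute[of _ "dF z"] inner_commute[of _ "dF z v* A"]
        dot_lmul_matrix)
qed

lemma grad_fobj_inner: "z \<in> X \<Longrightarrow> grad (fobj A F) z \<bullet> h = dF z \<bullet> (A *v h)"
  by (simp add: grad_fobj dot_lmul_matrix)

lemma grad_block_inner:
  "z \<in> X \<Longrightarrow> h \<in> block_space B i \<Longrightarrow> grad_block B A F i z \<bullet> h = dF z \<bullet> (A *v h)"
  by (simp add: grad_block_def block_part_inner grad_fobj_inner block_part_of_block_space)

lemma bgap_self: "bgap i z (bp i z) = 0"
  by (simp add: bgap_def)

text \<open>The linear term and \<open>g\<close> both split along the blocks, so the full gap is a
  sum of block gaps.\<close>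

lemma sum_bgap:
  "(\<Sum>i\<in>{1..N}. bgap i z (bp i q)) =
     dF z \<bullet> (A *v (z - q)) + (\<Sum>i\<in>{1..N}. gr i (bp i z)) - (\<Sum>i\<in>{1..N}. gr i (bp i q))"
proof -
  have "(\<Sum>i\<in>{1..N}. A *v (bp i z - bp i q)) = A *v (\<Sum>i\<in>{1..N}. bp i z - bp i q)"
    by (rule linear_sum[OF matrix_vector_mul_linear, symmetric])
  also have "\<dots> = A *v (z - q)" by (simp only: sum_subtractf sum_block_part)
  finally show ?thesis
    by (simp add: bgap_def sum.distrib sum_subtractf inner_sum_right[symmetric])
qed

lemma gobj_eq:
  assumes "z \<in> X"
  shows "gobj N B g z = ereal (\<Sum>i\<in>{1..N}. gr i (bp i z))"
proof -
  have "gobj N B g z = (\<Sum>i\<in>{1..N}. ereal (gr i (bp i z)))"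
    unfolding gobj_def using assms by (intro sum.cong) (simp_all add: in_X ereal_gr)
  then show ?thesis by simp
qed

lemma Hobj_eq: "z \<in> X \<Longrightarrow> Hobj N B A F g z = ereal (Hreal z)"
  by (simp add: Hobj_def Hreal_def gobj_eq fobj_def)

text \<open>One infinite summand makes the objective infinite, so the infimum over the whole space
  in \<open>Hstar\<close> is governed by \<open>X\<close>.\<close>

lemma Hobj_outside:
  assumes "z \<notin> X"
  shows "Hobj N B A F g z = \<infinity>"
proof -
  from assms obtain i where i: "i \<in> {1..N}" "bp i z \<notin> Xi i" by (auto simp: in_X)
  then have "g i (bp i z) = \<infinity>" by (simp add: Xblk_def edom_def)
  with i(1) have "gobj N B g z = \<infinity>"
    unfolding gobj_def by (subst sum_Pinfty) blast
  then show ?thesis by (simp add: Hobj_def)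
qed

section \<open>Gap inequality and descent of one block update\<close>

lemma Hreal_diff_le_sum_bgap:
  assumes z: "z \<in> X" and q: "q \<in> X"
  shows "Hreal z - Hreal q \<le> (\<Sum>i\<in>{1..N}. bgap i z (bp i q))"
proof -
  \<comment> \<open>Only \<open>F\<close> is linearized; the \<open>g\<close>-terms of the gap and
    of \<open>Hreal\<close> agree exactly.\<close>
  have "F (A *v z) + dF z \<bullet> (A *v q - A *v z) \<le> F (A *v q)"
    by (rule convex_on_above_tangent[OF F_convex _ _ GDERIV_F]) (use z q in auto)
  moreover have "dF z \<bullet> (A *v q - A *v z) = - (dF z \<bullet> (A *v (z - q)))"
    by (simp add: matrix_vector_mult_diff_distrib inner_diff_right)
  ultimately show ?thesis unfolding sum_bgap Hreal_def by linarith
qed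

lemma Sgap_eq:
  assumes z: "z \<in> X"
  shows "Sgap N B A F g z = (SUP q\<in>X. \<Sum>i\<in>{1..N}. bgap i z (bp i q))"
  unfolding Sgap_def sum_bgap
  by (intro SUP_cong refl) (simp add: grad_fobj_inner[OF z] gobj_eq z)

text \<open>The descent inequality is applied to \<open>F\<close> along \<open>A *v h\<close> with
  constant \<open>\<beta> i\<close>, and convexity of \<open>g i\<close> bounds the only summand of
  \<open>g\<close> that changes. The whole segment stays in \<open>X\<close>, where the block
  Lipschitz condition is available.\<close>

lemma block_descent:
  assumes i: "i \<in> {1..N}" and z: "z \<in> X" and q: "q \<in> Xi i" and a: "0 \<le> a" "a \<le> 1"
  shows "Hreal (z + a *\<^sub>R (q - bp i z))
    \<le> Hreal z - (a * bgap i z q - a\<^sup>2 * (\<beta> i / 2 * (norm (A *v (q - bp i z)))\<^sup>2))"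
proof -
  define h where "h = a *\<^sub>R (q - bp i z)"
  have qi: "q \<in> block_space B i" using q by (rule Xi_block_space)
  have h: "t *\<^sub>R h \<in> block_space B i" for t
    unfolding h_def
    by (intro subspace_scale subspace_diff subspace_block_space qi block_part_in_space)
  have seg: "z + t *\<^sub>R h \<in> X" if "0 \<le> t" "t \<le> 1" for t
    using update_in_X[OF i z q, of "t * a"] that a by (simp add: h_def mult_le_one)
  have Aseg: "A *v z + t *\<^sub>R (A *v h) = A *v (z + t *\<^sub>R h)" for t
    by (simp add: matrix_vector_right_distrib matrix_vector_mult_scaleR)
  have "F (A *v z + A *v h) \<le> F (A *v z) + dF z \<bullet> (A *v h) + \<beta> i / 2 * (norm (A *v h))\<^sup>2"
  proof (rule descent_along_segment)
    fix t :: real assume t: "0 \<le> t" "t \<le> 1"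
    show "GDERIV F (A *v z + t *\<^sub>R (A *v h)) :> grad F (A *v z + t *\<^sub>R (A *v h))"
      unfolding Aseg by (rule GDERIV_F) (rule seg[OF t])
    have bph: "bp i h = h" using h[of 1] by (simp add: block_part_of_block_space)
    show "norm (grad F (A *v z + t *\<^sub>R (A *v h)) - dF z) \<le> \<beta> i * norm (t *\<^sub>R (A *v h))"
      using \<beta>_lipschitz[OF i z h[of t]] seg[OF t]
      by (simp only: Umat_mult block_mat_mult block_part_scaleR bph matrix_vector_mult_scaleR)
  qed
  then have F_le: "F (A *v (z + h)) \<le> F (A *v z) + dF z \<bullet> (A *v h) + \<beta> i / 2 * (norm (A *v h))\<^sup>2"
    by (simp add: matrix_vector_right_distrib)
  have "(\<Sum>j\<in>{1..N}. gr j (bp j (z + h))) - (\<Sum>j\<in>{1..N}. gr j (bp j z))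
      = (\<Sum>j\<in>{1..N}. gr j (bp j (z + h)) - gr j (bp j z))"
    by (simp add: sum_subtractf)
  also have "\<dots> = (\<Sum>j\<in>{1..N}. if j = i then gr i (bp i z + h) - gr i (bp i z) else 0)"
    unfolding h_def by (rule sum.cong) (auto simp: block_part_update[OF qi])
  also have "\<dots> = gr i (bp i z + h) - gr i (bp i z)" using i by simp
  also have "\<dots> \<le> a * (gr i q - gr i (bp i z))"
    using Xi_convex_comb(2)[OF i _ q a, of "bp i z"] z i unfolding h_def by (auto simp: in_X)
  finally have g_le: "(\<Sum>j\<in>{1..N}. gr j (bp j (z + h)))
      \<le> (\<Sum>j\<in>{1..N}. gr j (bp j z)) + a * (gr i q - gr i (bp i z))" by simp
  have Ah: "A *v h = a *\<^sub>R (A *v (q - bp i z))"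
    by (simp add: h_def matrix_vector_mult_scaleR)
  have "dF z \<bullet> (A *v h) = - a * (dF z \<bullet> (A *v (bp i z - q)))"
    unfolding Ah by (simp add: matrix_vector_mult_diff_distrib inner_diff_right algebra_simps)
  moreover have "(norm (A *v h))\<^sup>2 = a\<^sup>2 * (norm (A *v (q - bp i z)))\<^sup>2"
    unfolding Ah by (simp add: power_mult_distrib)
  ultimately show ?thesis
    using F_le g_le unfolding Hreal_def h_def[symmetric] bgap_def by (simp add: algebra_simps)
qed

section \<open>Boundedness of \<open>X\<close> and the bound \<open>K\<^sub>i\<close> on block
  gaps\<close>

lemma X_bounded: "bounded X"
proof -
  have "\<forall>i\<in>{1..N}. \<exists>b. \<forall>v\<in>Xi i. norm v \<le> b"
    using compact_imp_bounded[OF X_compact] by (auto simp: bounded_iff)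
  then obtain b where b: "\<And>i v. i \<in> {1..N} \<Longrightarrow> v \<in> Xi i \<Longrightarrow> norm v \<le> b i"
    by (metis (full_types))
  have "norm z \<le> (\<Sum>i\<in>{1..N}. b i)" if "z \<in> X" for z
  proof -
    have "norm (\<Sum>i\<in>{1..N}. bp i z) \<le> (\<Sum>i\<in>{1..N}. b i)"
      using that by (intro sum_norm_le b) (auto simp: in_X)
    then show ?thesis by (simp only: sum_block_part)
  qed
  then show ?thesis by (auto simp: bounded_iff)
qed

lemma norm_diff_le_diameter: "z \<in> X \<Longrightarrow> q \<in> X \<Longrightarrow> norm (z - q) \<le> diameter X"
  using diameter_bounded_bound[OF X_bounded] by (simp add: dist_norm)

text \<open>The real supremum in \<open>Mblk\<close> dominates its terms once they are bounded
  above. They are, because a Lipschitz gradient is bounded on the bounded image of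
  \<open>X\<close>.\<close>

lemma norm_grad_block_le:
  assumes z: "z \<in> X"
  shows "norm (grad_block B A F i z) \<le> Mblk N B A F g i"
proof -
  have "bounded ((\<lambda>z. A *v z) ` X)"
    by (intro bounded_linear_image X_bounded matrix_vector_mul_bounded_linear)
  then have "bounded (grad F ` (\<lambda>z. A *v z) ` X)"
    by (rule bounded_uniformly_continuous_image[OF lipschitz_on_uniformly_continuous[OF F_lipschitz]])
  then have "bounded ((\<lambda>v. transpose A *v v) ` grad F ` (\<lambda>z. A *v z) ` X)"
    by (rule bounded_linear_image) (rule matrix_vector_mul_bounded_linear)
  then obtain C where C: "\<And>w. w \<in> X \<Longrightarrow> norm (transpose A *v dF w) \<le> C"
    unfolding bounded_iff by blast
  have "norm (grad_block B A F i w) \<le> C" if "w \<in> X" for w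
    using norm_block_part_le[of B i "transpose A *v dF w"] C[OF that]
    by (simp add: grad_block_def grad_fobj[OF that])
  then have "bdd_above ((\<lambda>w. norm (grad_block B A F i w)) ` X)" by (auto simp: bdd_above_def)
  with z show ?thesis unfolding Mblk_def by (rule cSUP_upper)
qed

lemma norm_diff_le_diameter_Xi:
  assumes "i \<in> {1..N}" "u \<in> Xi i" "v \<in> Xi i"
  shows "norm (u - v) \<le> diameter (Xi i)"
  using diameter_bounded_bound[OF compact_imp_bounded[OF X_compact[OF assms(1)]] assms(2,3)]
  by (simp add: dist_norm)

text \<open>The linear term and the difference of \<open>g i\<close> are at most
  \<open>M\<^sub>i\<close> and \<open>l i\<close> times the distance from \<open>bp i z\<close> to
  \<open>q\<close>, which is at most \<open>D\<^sub>i\<close>.\<close>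

lemma bgap_le_Kblk:
  assumes i: "i \<in> {1..N}" and z: "z \<in> X" and q: "q \<in> Xi i"
  shows "bgap i z q \<le> Kblk N B A F g l i"
proof -
  let ?h = "bp i z - q"
  have zi: "bp i z \<in> Xi i" using i z by (simp add: in_X)
  have "dF z \<bullet> (A *v ?h) = grad_block B A F i z \<bullet> ?h"
    by (rule grad_block_inner[OF z, symmetric])
      (intro subspace_diff subspace_block_space block_part_in_space Xi_block_space[OF q])
  also have "\<dots> \<le> Mblk N B A F g i * norm ?h"
    by (rule order_trans[OF norm_cauchy_schwarz]) (intro mult_right_mono norm_grad_block_le z norm_ge_zero)
  finally have 1: "dF z \<bullet> (A *v ?h) \<le> Mblk N B A F g i * norm ?h" .
  have 2: "gr i (bp i z) - gr i q \<le> l i * norm ?h"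
    using lipschitz_onD[OF g_lipschitz[OF i] zi q] by (simp add: dist_real_def dist_norm)
  have "0 \<le> Mblk N B A F g i" using norm_grad_block_le[OF z, of i] norm_ge_zero order_trans by blast
  moreover have "0 \<le> l i" using lipschitz_on_nonneg[OF g_lipschitz[OF i]] .
  ultimately have "(Mblk N B A F g i + l i) * norm ?h \<le> Kblk N B A F g l i"
    unfolding Kblk_def by (intro mult_left_mono norm_diff_le_diameter_Xi i zi q) simp
  with 1 2 show ?thesis by (simp add: bgap_def algebra_simps)
qed

end

subsection \<open>The iteration\<close>

locale cbcg_run = composite_problem N B A F g l \<beta> LF
  for N and B :: "'d::finite \<Rightarrow> nat" and A :: "real ^ 'd ^ 'm::finite" and F g l \<beta> LF +
  fixes x :: "nat \<Rightarrow> real ^ 'd"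
    and y p :: "nat \<Rightarrow> nat \<Rightarrow> real ^ 'd"
    and \<alpha> :: "nat \<Rightarrow> nat \<Rightarrow> real"
  assumes cbcg: "cbcg_method N B A F g x y p \<alpha>"
    and adaptive: "adaptive_stepsize N B A F g \<beta> x y p \<alpha>"
begin

text \<open>The block gap at the inner iterate, evaluated at the chosen point;
  \<open>Sblk_eq\<close> identifies it with the maximum \<open>S\<^sub>i\<close>.\<close>

definition S :: "nat \<Rightarrow> nat \<Rightarrow> real" where
  "S k i = bgap i (y k (i - 1)) (p k i)"

definition w :: "nat \<Rightarrow> nat \<Rightarrow> real" where
  "w k i = norm (A *v (p k i - bp i (y k (i - 1))))"

text \<open>The decrease of \<open>H\<close> in block step \<open>i\<close> that the quadratic model guarantees.\<close>

definition decr :: "nat \<Rightarrow> nat \<Rightarrow> real" where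
  "decr k i = \<alpha> k i * S k i - (\<alpha> k i)\<^sup>2 * (\<beta> i / 2 * (w k i)\<^sup>2)"

definition C1 :: real where
  "C1 = (MAX i\<in>{1..N}. max (\<beta> i * (snorm i)\<^sup>2 * (diameter (Xi i))\<^sup>2) (Kblk N B A F g l i))"

definition Q :: real where "Q = (MAX i\<in>{1..N}. (snorm i)\<^sup>2)"

definition \<beta>min :: real where "\<beta>min = (MIN i\<in>{1..N}. \<beta> i)"

definition \<gamma> :: real where "\<gamma> = real N * C2const N B A F g l LF \<beta>"

lemma \<gamma>_eq: "\<gamma> = 4 * real N * (C1 + real N * LF\<^sup>2 * (diameter X)\<^sup>2 * Q / \<beta>min)"
  by (simp add: \<gamma>_def C2const_def C1_def Q_def \<beta>min_def)

section \<open>Feasibility of the iterates and maximality of the chosen block points\<close>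

lemma y_0: "y k 0 = x k"
  and x_Suc: "x (Suc k) = y k N"
  and x_0: "x 0 \<in> X"
  using cbcg by (auto simp: cbcg_method_def)

lemma p_arg_min:
  "i \<in> {1..N} \<Longrightarrow> is_arg_min (\<lambda>q. grad_block B A F i (y k (i - 1)) \<bullet> q + gr i q) (\<lambda>q. q \<in> Xi i) (p k i)"
  using cbcg by (auto simp: cbcg_method_def)

lemma p_in: "i \<in> {1..N} \<Longrightarrow> p k i \<in> Xi i"
  using p_arg_min by (auto simp: is_arg_min_def)

lemma y_step: "i \<in> {1..N} \<Longrightarrow> y k i = y k (i - 1) + \<alpha> k i *\<^sub>R (p k i - bp i (y k (i - 1)))"
  using cbcg by (simp add: cbcg_method_def)

lemma \<alpha>_bounds: "i \<in> {1..N} \<Longrightarrow> 0 \<le> \<alpha> k i" "i \<in> {1..N} \<Longrightarrow> \<alpha> k i \<le> 1"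
  using adaptive by (force simp: adaptive_stepsize_def is_arg_min_def)+

text \<open>Feasibility of \<open>x k\<close> remains a premise because it comes from the preceding
  cycle; the induction over cycles in \<open>x_in_X\<close> then discharges it.\<close>

lemma y_in_X_if: "x k \<in> X \<Longrightarrow> j \<le> N \<Longrightarrow> y k j \<in> X"
proof (induction j)
  case 0
  then show ?case by (simp add: y_0)
next
  case (Suc j)
  then have i: "Suc j \<in> {1..N}" by simp
  have "y k j \<in> X" using Suc by simp
  then show ?case
    using y_step[OF i, of k] update_in_X[OF i _ p_in[OF i] \<alpha>_bounds[OF i]] by simp
qed

lemma x_in_X: "x k \<in> X"
  by (induction k) (simp_all add: x_0 x_Suc y_in_X_if)

lemma y_in_X: "j \<le> N \<Longrightarrow> y k j \<in> X"
  by (rule y_in_X_if[OF x_in_X])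

text \<open>Steps up to \<open>j\<close> move only blocks with labels up to \<open>j\<close>, so a
  block keeps its value from the start of the cycle until its turn comes.\<close>

lemma block_part_y: "j \<le> N \<Longrightarrow> j < i \<Longrightarrow> bp i (y k j) = bp i (x k)"
proof (induction j)
  case 0
  then show ?case by (simp add: y_0)
next
  case (Suc j)
  then have j: "Suc j \<in> {1..N}" by simp
  have "bp i (y k (Suc j)) = bp i (y k j)"
    using y_step[OF j, of k] block_part_update[OF Xi_block_space[OF p_in[OF j]]] Suc.prems by simp
  with Suc show ?case by simp
qed

lemma pred_y_in_X: "i \<in> {1..N} \<Longrightarrow> y k (i - 1) \<in> X"
  by (rule y_in_X) auto

lemma block_part_pred_y: "i \<in> {1..N} \<Longrightarrow> bp i (y k (i - 1)) = bp i (x k)"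
  by (rule block_part_y) auto

text \<open>As functions of \<open>q\<close>, the linearized objective and \<open>bgap\<close> add
  up to a constant, so the minimizer \<open>p k i\<close> of the one maximizes the other.\<close>

lemma bgap_le_S:
  assumes i: "i \<in> {1..N}" and q: "q \<in> Xi i"
  shows "bgap i (y k (i - 1)) q \<le> S k i"
proof -
  let ?z = "y k (i - 1)"
  have inner: "grad_block B A F i ?z \<bullet> q = dF ?z \<bullet> (A *v q)" if "q \<in> Xi i" for q
    by (rule grad_block_inner[OF pred_y_in_X[OF i] Xi_block_space[OF that]])
  have "\<not> grad_block B A F i ?z \<bullet> q + gr i q < grad_block B A F i ?z \<bullet> p k i + gr i (p k i)"
    using p_arg_min[OF i, of k] q by (auto simp: is_arg_min_def)
  then show ?thesis
    unfolding S_def bgap_def inner[OF q] inner[OF p_in[OF i]]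
    by (simp add: matrix_vector_mult_diff_distrib inner_diff_right)
qed

lemma S_nonneg:
  assumes i: "i \<in> {1..N}"
  shows "0 \<le> S k i"
proof -
  have "bp i (y k (i - 1)) \<in> Xi i" using pred_y_in_X[OF i] i by (simp add: in_X)
  from bgap_le_S[OF i this, of k] show ?thesis by (simp only: bgap_self)
qed

lemma Sblk_eq:
  assumes i: "i \<in> {1..N}"
  shows "Sblk B A F g i (y k (i - 1)) = S k i"
proof -
  let ?z = "y k (i - 1)"
  have "grad_block B A F i ?z \<bullet> (bp i ?z - q) = dF ?z \<bullet> (A *v (bp i ?z - q))" if "q \<in> Xi i" for q
    by (rule grad_block_inner[OF pred_y_in_X[OF i]])
      (intro subspace_diff subspace_block_space block_part_in_space Xi_block_space[OF that])
  then have "Sblk B A F g i ?z = (SUP q\<in>Xi i. bgap i ?z q)"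
    unfolding Sblk_def bgap_def by (intro SUP_cong refl) simp
  also have "\<dots> = S k i"
    by (rule cSup_eq_maximum) (use bgap_le_S[OF i] p_in[OF i] in \<open>auto simp: S_def\<close>)
  finally show ?thesis .
qed

section \<open>Decrease guaranteed by one block step\<close>

lemma C1_ge:
  assumes "i \<in> {1..N}"
  shows "\<beta> i * (snorm i)\<^sup>2 * (diameter (Xi i))\<^sup>2 \<le> C1" "Kblk N B A F g l i \<le> C1"
proof -
  have "max (\<beta> i * (snorm i)\<^sup>2 * (diameter (Xi i))\<^sup>2) (Kblk N B A F g l i) \<le> C1"
    unfolding C1_def using assms by (intro Max_ge) auto
  then show "\<beta> i * (snorm i)\<^sup>2 * (diameter (Xi i))\<^sup>2 \<le> C1" "Kblk N B A F g l i \<le> C1" by auto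
qed

lemma Q_ge: "i \<in> {1..N} \<Longrightarrow> (snorm i)\<^sup>2 \<le> Q"
  unfolding Q_def by (intro Max_ge) auto

lemma \<beta>min_le: "i \<in> {1..N} \<Longrightarrow> \<beta>min \<le> \<beta> i"
  unfolding \<beta>min_def by (intro Min_le) auto

lemma \<beta>min_pos: "0 < \<beta>min"
  unfolding \<beta>min_def using N_pos \<beta>_pos by (subst Min_gr_iff) auto

lemma Q_nonneg: "0 \<le> Q"
  using Q_ge[of 1] N_pos by (auto intro: order_trans[OF zero_le_power2])

lemma C1_nonneg: "0 \<le> C1"
proof -
  have 1: "1 \<in> {1..N}" using N_pos by auto
  have "0 \<le> \<beta> 1 * (snorm 1)\<^sup>2 * (diameter (Xi 1))\<^sup>2" using \<beta>_pos[OF 1] by simp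
  also have "\<dots> \<le> C1" by (rule C1_ge[OF 1])
  finally show ?thesis .
qed

lemma \<gamma>_nonneg: "0 \<le> \<gamma>"
  unfolding \<gamma>_eq using C1_nonneg Q_nonneg \<beta>min_pos by simp

text \<open>These are the three facts about the quadratic model, with \<open>C1\<close> as the bound
  \<open>C\<close>. The two terms of the maximum in \<open>C1\<close> serve its two requirements:
  curvature, via \<open>w k i \<le> snorm i * diameter (Xi i)\<close>, and gap, via
  \<open>Kblk\<close>.\<close>

lemma
  assumes i: "i \<in> {1..N}"
  shows decr_nonneg: "0 \<le> decr k i"
    and step_sq_le_decr: "\<beta>min * (\<alpha> k i * w k i)\<^sup>2 \<le> 2 * decr k i"
    and S_sq_le_decr: "(S k i)\<^sup>2 \<le> 2 * C1 * decr k i"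
proof -
  let ?b = "\<beta> i / 2 * (w k i)\<^sup>2"
  have z: "bp i (y k (i - 1)) \<in> Xi i" using pred_y_in_X[OF i] i by (simp add: in_X)
  have pz: "p k i - bp i (y k (i - 1)) \<in> block_space B i"
    by (intro subspace_diff subspace_block_space block_part_in_space Xi_block_space[OF p_in[OF i]])
  \<comment> \<open>The stepsize rule speaks of \<open>block_mat\<close> and \<open>x k\<close>. It
    agrees with \<open>w k i\<close> since the direction lies in block \<open>i\<close>, which has
    not moved yet.\<close>
  have w_eq: "norm (block_mat B A i *v (p k i - bp i (x k))) = w k i"
    unfolding w_def block_mat_mult block_part_pred_y[OF i, of k, symmetric]
    using pz by (simp add: block_part_of_block_space)
  have "is_arg_min (\<lambda>a. - a * Sblk B A F g i (y k (i - 1)) + a\<^sup>2 * (\<beta> i / 2) * (w k i)\<^sup>2)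
      (\<lambda>a. a \<in> {0..1}) (\<alpha> k i)"
    using adaptive i unfolding adaptive_stepsize_def w_eq[symmetric] by blast
  then have am: "is_arg_min (\<lambda>a. - a * S k i + a\<^sup>2 * ?b) (\<lambda>a. a \<in> {0..1}) (\<alpha> k i)"
    by (simp only: Sblk_eq[OF i] mult.assoc)
  have b: "0 \<le> ?b" using \<beta>_pos[OF i] by simp
  note model = quadratic_argmin[OF am S_nonneg[OF i] b]
  show "0 \<le> decr k i" unfolding decr_def by (rule model(1))
  have "\<beta>min * (\<alpha> k i * w k i)\<^sup>2 \<le> \<beta> i * (\<alpha> k i * w k i)\<^sup>2"
    using \<beta>min_le[OF i] by (intro mult_right_mono) auto
  also have "\<dots> = 2 * ((\<alpha> k i)\<^sup>2 * ?b)" by (simp add: power_mult_distrib)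
  also have "\<dots> \<le> 2 * decr k i" unfolding decr_def by (intro mult_left_mono model(2)) simp
  finally show "\<beta>min * (\<alpha> k i * w k i)\<^sup>2 \<le> 2 * decr k i" .
  have "w k i \<le> snorm i * norm (p k i - bp i (y k (i - 1)))"
    unfolding w_def by (rule norm_block_mat_le[OF pz])
  also have "\<dots> \<le> snorm i * diameter (Xi i)"
    by (intro mult_left_mono norm_diff_le_diameter_Xi i p_in z)
      (simp add: spectral_norm_def onorm_pos_le matrix_vector_mul_bounded_linear)
  finally have "(w k i)\<^sup>2 \<le> (snorm i * diameter (Xi i))\<^sup>2"
    by (intro power_mono) (simp_all add: w_def)
  then have "\<beta> i * (w k i)\<^sup>2 \<le> \<beta> i * (snorm i * diameter (Xi i))\<^sup>2"
    using \<beta>_pos[OF i] by simp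
  then have "2 * ?b \<le> C1" using C1_ge(1)[OF i] by (simp add: power_mult_distrib mult.assoc)
  moreover have "S k i \<le> C1"
    unfolding S_def using bgap_le_Kblk[OF i pred_y_in_X[OF i] p_in[OF i]] C1_ge(2)[OF i] by (rule order_trans)
  ultimately show "(S k i)\<^sup>2 \<le> 2 * C1 * decr k i" unfolding decr_def by (rule model(3))
qed

lemma Hreal_y_le: "j \<le> N \<Longrightarrow> Hreal (y k j) \<le> Hreal (x k) - (\<Sum>i\<in>{1..j}. decr k i)"
proof (induction j)
  case 0
  then show ?case by (simp add: y_0)
next
  case (Suc j)
  then have i: "Suc j \<in> {1..N}" by simp
  have "Hreal (y k (Suc j)) \<le> Hreal (y k j) - decr k (Suc j)"
    using block_descent[OF i pred_y_in_X[OF i] p_in[OF i] \<alpha>_bounds[OF i], of k k k] y_step[OF i, of k]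
    by (simp add: decr_def S_def w_def)
  with Suc show ?case by simp
qed

lemma sum_decr_le: "(\<Sum>i\<in>{1..N}. decr k i) \<le> Hreal (x k) - Hreal (x (Suc k))"
  using Hreal_y_le[of N k] by (simp add: x_Suc)

lemma sum_decr_nonneg: "0 \<le> (\<Sum>i\<in>{1..N}. decr k i)"
  by (rule sum_nonneg) (rule decr_nonneg)

section \<open>From block gaps at inner iterates to the full gap at \<open>x k\<close>\<close>

lemma norm_A_diff_y:
  "j \<le> N \<Longrightarrow> norm (A *v (x k - y k j)) \<le> (\<Sum>i\<in>{1..j}. \<alpha> k i * w k i)"
proof (induction j)
  case 0
  then show ?case by (simp add: y_0)
next
  case (Suc j)
  then have i: "Suc j \<in> {1..N}" by simp
  let ?d = "p k (Suc j) - bp (Suc j) (y k j)"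
  have "x k - y k (Suc j) = (x k - y k j) - \<alpha> k (Suc j) *\<^sub>R ?d"
    using y_step[OF i, of k] by simp
  then have "A *v (x k - y k (Suc j)) = A *v (x k - y k j) - \<alpha> k (Suc j) *\<^sub>R (A *v ?d)"
    by (simp only: matrix_vector_mult_diff_distrib matrix_vector_mult_scaleR)
  then have "norm (A *v (x k - y k (Suc j))) \<le> norm (A *v (x k - y k j)) + \<alpha> k (Suc j) * w k (Suc j)"
    using norm_triangle_ineq4[of "A *v (x k - y k j)" "\<alpha> k (Suc j) *\<^sub>R (A *v ?d)"]
      \<alpha>_bounds(1)[OF i] by (simp add: w_def)
  with Suc show ?case by simp
qed

text \<open>Cyclic updating evaluates the block gaps at \<open>y k (i - 1)\<close> rather than at \<open>x k\<close>; the
  resulting error is controlled by the steps taken so far.\<close>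

lemma bgap_x_le:
  assumes i: "i \<in> {1..N}" and q: "q \<in> X"
  shows "bgap i (x k) (bp i q)
    \<le> S k i + LF * (\<Sum>j\<in>{1..N}. \<alpha> k j * w k j) * norm (A *v bp i (x k - q))"
proof -
  let ?z = "y k (i - 1)" and ?h = "A *v bp i (x k - q)"
  have LF: "0 \<le> LF" by (rule lipschitz_on_nonneg[OF F_lipschitz])
  have qi: "bp i q \<in> Xi i" using i q by (simp add: in_X)
  have "norm (dF (x k) - dF ?z) \<le> LF * norm (A *v (x k - ?z))"
    using lipschitz_onD[OF F_lipschitz, of "A *v x k" "A *v ?z"] x_in_X pred_y_in_X[OF i]
    by (simp add: dist_norm matrix_vector_mult_diff_distrib)
  also have "norm (A *v (x k - ?z)) \<le> (\<Sum>j\<in>{1..i-1}. \<alpha> k j * w k j)"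
    by (rule norm_A_diff_y) (use i in auto)
  \<comment> \<open>Extending the sum to all blocks makes the bound independent of
    \<open>i\<close>.\<close>
  also have "\<dots> \<le> (\<Sum>j\<in>{1..N}. \<alpha> k j * w k j)"
    by (rule sum_mono2) (use i \<alpha>_bounds(1) in \<open>auto simp: w_def\<close>)
  finally have dF: "norm (dF (x k) - dF ?z) \<le> LF * (\<Sum>j\<in>{1..N}. \<alpha> k j * w k j)"
    using LF by (simp add: mult_left_mono)
  \<comment> \<open>Block \<open>i\<close> is the same in \<open>x k\<close> and \<open>?z\<close>,
    so the two gaps differ only in the gradient.\<close>
  have "bgap i (x k) (bp i q) = bgap i ?z (bp i q) + (dF (x k) - dF ?z) \<bullet> ?h"
    unfolding bgap_def block_part_pred_y[OF i] block_part_diff inner_diff_left by simp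
  also have "\<dots> \<le> S k i + norm (dF (x k) - dF ?z) * norm ?h"
    by (intro add_mono bgap_le_S i qi norm_cauchy_schwarz)
  also have "\<dots> \<le> S k i + LF * (\<Sum>j\<in>{1..N}. \<alpha> k j * w k j) * norm ?h"
    by (intro add_left_mono mult_right_mono dF norm_ge_zero)
  finally show ?thesis .
qed

text \<open>Adding the block estimates gives the sum of the \<open>S k i\<close> plus
  \<open>LF * R * U\<close>. Each of these three sums is bounded through its squares at the cost of
  a factor \<open>N\<close>: the first two by the decreases, the last by the diameter of
  \<open>X\<close>.\<close>

lemma sum_bgap_x_le:
  assumes q: "q \<in> X"
  shows "(\<Sum>i\<in>{1..N}. bgap i (x k) (bp i q)) \<le> sqrt (\<gamma> * (\<Sum>i\<in>{1..N}. decr k i))"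
proof -
  define E where "E = (\<Sum>i\<in>{1..N}. decr k i)"
  define R where "R = (\<Sum>j\<in>{1..N}. \<alpha> k j * w k j)"
  define U where "U = (\<Sum>i\<in>{1..N}. norm (A *v bp i (x k - q)))"
  define D where "D = diameter X"
  have E: "0 \<le> E" unfolding E_def by (rule sum_decr_nonneg)
  have S_sq: "(\<Sum>i\<in>{1..N}. S k i)\<^sup>2 \<le> 2 * real N * C1 * E"
  proof -
    have "(\<Sum>i\<in>{1..N}. (S k i)\<^sup>2) \<le> (\<Sum>i\<in>{1..N}. 2 * C1 * decr k i)"
      by (intro sum_mono S_sq_le_decr)
    then have "(\<Sum>i\<in>{1..N}. (S k i)\<^sup>2) * real N \<le> 2 * C1 * E * real N"
      unfolding E_def sum_distrib_left by (intro mult_right_mono) auto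
    with sum_squared_le_sum_of_squares[of "S k" "{1..N}"] show ?thesis by (simp add: mult_ac)
  qed
  have R_sq: "R\<^sup>2 \<le> 2 * real N * E / \<beta>min"
  proof -
    have "\<beta>min * (\<Sum>i\<in>{1..N}. (\<alpha> k i * w k i)\<^sup>2) \<le> 2 * E"
      unfolding E_def sum_distrib_left by (intro sum_mono step_sq_le_decr)
    then have "(\<Sum>i\<in>{1..N}. (\<alpha> k i * w k i)\<^sup>2) * real N \<le> 2 * E / \<beta>min * real N"
      using \<beta>min_pos by (intro mult_right_mono) (auto simp: pos_le_divide_eq mult.commute)
    with sum_squared_le_sum_of_squares[of "\<lambda>i. \<alpha> k i * w k i" "{1..N}"] show ?thesis
      by (simp add: R_def mult_ac)
  qed
  have U_sq: "U\<^sup>2 \<le> real N * Q * D\<^sup>2"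
  proof -
    have "(norm (A *v bp i (x k - q)))\<^sup>2 \<le> Q * (norm (bp i (x k - q)))\<^sup>2" if i: "i \<in> {1..N}" for i
    proof -
      have "(norm (A *v bp i (x k - q)))\<^sup>2 \<le> (snorm i * norm (bp i (x k - q)))\<^sup>2"
        by (intro power_mono norm_block_mat_le) auto
      also have "\<dots> \<le> Q * (norm (bp i (x k - q)))\<^sup>2"
        unfolding power_mult_distrib by (intro mult_right_mono Q_ge i) simp
      finally show ?thesis .
    qed
    then have "(\<Sum>i\<in>{1..N}. (norm (A *v bp i (x k - q)))\<^sup>2) \<le> (\<Sum>i\<in>{1..N}. Q * (norm (bp i (x k - q)))\<^sup>2)"
      by (rule sum_mono)
    \<comment> \<open>The blocks are orthogonal, so the squares add up to one squared norm and no
      further factor \<open>N\<close> arises.\<close>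
    also have "\<dots> = Q * (norm (x k - q))\<^sup>2"
      by (simp only: sum_distrib_left[symmetric] sum_norm_block_part)
    also have "\<dots> \<le> Q * D\<^sup>2"
      unfolding D_def by (intro mult_left_mono power_mono norm_diff_le_diameter x_in_X q Q_nonneg) simp
    finally have "(\<Sum>i\<in>{1..N}. (norm (A *v bp i (x k - q)))\<^sup>2) * real N \<le> Q * D\<^sup>2 * real N"
      by (intro mult_right_mono) auto
    with sum_squared_le_sum_of_squares[of "\<lambda>i. norm (A *v bp i (x k - q))" "{1..N}"] show ?thesis
      by (simp add: U_def mult_ac)
  qed
  have "(\<Sum>i\<in>{1..N}. bgap i (x k) (bp i q))
      \<le> (\<Sum>i\<in>{1..N}. S k i + LF * R * norm (A *v bp i (x k - q)))"
    unfolding R_def by (intro sum_mono bgap_x_le q)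
  also have "\<dots> = (\<Sum>i\<in>{1..N}. S k i) + LF * R * U"
    by (simp add: U_def sum.distrib sum_distrib_left)
  also have "\<dots> \<le> sqrt (\<gamma> * E)"
  proof (rule real_le_rsqrt)
    let ?a = "\<Sum>i\<in>{1..N}. S k i"
    \<comment> \<open>The factor 2 of this split and the 2 in the decrease bounds produce the 4 in
      \<open>C\<^sub>2\<close>.\<close>
    have "(?a + LF * R * U)\<^sup>2 \<le> 2 * ?a\<^sup>2 + 2 * (LF * R * U)\<^sup>2"
      using zero_le_power2[of "?a - LF * R * U"] by (simp add: power2_sum power2_diff)
    also have "(LF * R * U)\<^sup>2 = LF\<^sup>2 * (R\<^sup>2 * U\<^sup>2)" by (simp add: power_mult_distrib)
    also have "\<dots> \<le> LF\<^sup>2 * (2 * real N * E / \<beta>min * (real N * Q * D\<^sup>2))"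
      using E \<beta>min_pos by (intro mult_left_mono mult_mono R_sq U_sq) auto
    finally have "(?a + LF * R * U)\<^sup>2
        \<le> 2 * (2 * real N * C1 * E) + 2 * (LF\<^sup>2 * (2 * real N * E / \<beta>min * (real N * Q * D\<^sup>2)))"
      using S_sq by linarith
    also have "\<dots> = \<gamma> * E" unfolding \<gamma>_eq D_def by (simp add: algebra_simps)
    finally show "(?a + LF * R * U)\<^sup>2 \<le> \<gamma> * E" .
  qed
  finally show ?thesis unfolding E_def .
qed

text \<open>The real supremum dominates its terms because \<open>sum_bgap_x_le\<close> bounds them
  uniformly in \<open>q\<close>.\<close>

lemma sum_bgap_le_Sgap: "q \<in> X \<Longrightarrow> (\<Sum>i\<in>{1..N}. bgap i (x k) (bp i q)) \<le> Sgap N B A F g (x k)"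
  unfolding Sgap_eq[OF x_in_X]
  by (rule cSUP_upper, assumption) (rule bdd_aboveI2, rule sum_bgap_x_le)

lemma Sgap_nonneg: "0 \<le> Sgap N B A F g (x k)"
  using sum_bgap_le_Sgap[OF x_in_X, of k k] by (simp add: bgap_self)

lemma Sgap_sq_le: "(Sgap N B A F g (x k))\<^sup>2 \<le> \<gamma> * (Hreal (x k) - Hreal (x (Suc k)))"
proof -
  have "Sgap N B A F g (x k) \<le> sqrt (\<gamma> * (\<Sum>i\<in>{1..N}. decr k i))"
    unfolding Sgap_eq[OF x_in_X] using x_in_X by (intro cSUP_least sum_bgap_x_le) auto
  then have "(Sgap N B A F g (x k))\<^sup>2 \<le> (sqrt (\<gamma> * (\<Sum>i\<in>{1..N}. decr k i)))\<^sup>2"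
    by (rule power_mono) (rule Sgap_nonneg)
  also have "\<dots> = \<gamma> * (\<Sum>i\<in>{1..N}. decr k i)"
    using \<gamma>_nonneg sum_decr_nonneg by simp
  also have "\<dots> \<le> \<gamma> * (Hreal (x k) - Hreal (x (Suc k)))"
    by (intro mult_left_mono sum_decr_le \<gamma>_nonneg)
  finally show ?thesis .
qed

section \<open>The two convergence rates\<close>

lemma Sgap_le_start: "Sgap N B A F g (x k) \<le> \<gamma> / 4"
  unfolding Sgap_eq[OF x_in_X]
proof (rule cSUP_least)
  fix q assume q: "q \<in> X"
  \<comment> \<open>This crude bound by the constants \<open>K\<^sub>i\<close> supplies the initial
    condition \<open>\<gamma> / 4\<close> of both scalar lemmas.\<close>
  have "(\<Sum>i\<in>{1..N}. bgap i (x k) (bp i q)) \<le> (\<Sum>i\<in>{1..N}. C1)"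
  proof (rule sum_mono)
    fix i assume i: "i \<in> {1..N}"
    then have "bgap i (x k) (bp i q) \<le> Kblk N B A F g l i"
      using q by (intro bgap_le_Kblk x_in_X) (auto simp: in_X)
    with C1_ge(2)[OF i] show "bgap i (x k) (bp i q) \<le> C1" by linarith
  qed
  also have "\<dots> = real N * C1" by simp
  also have "\<dots> \<le> real N * (C1 + real N * LF\<^sup>2 * (diameter X)\<^sup>2 * Q / \<beta>min)"
    using Q_nonneg \<beta>min_pos by (intro mult_left_mono) auto
  also have "\<dots> = \<gamma> / 4" by (simp add: \<gamma>_eq)
  finally show "(\<Sum>i\<in>{1..N}. bgap i (x k) (bp i q)) \<le> \<gamma> / 4" .
qed (use x_in_X in auto)

text \<open>The comparison point \<open>z\<close> is left free in \<open>X\<close> for two uses: the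
  infimum over \<open>z\<close> gives the rate for \<open>H\<close>, and a later iterate as
  \<open>z\<close> gives the \<open>decay\<close> premise of
  \<open>harmonic_decay_min\<close>.\<close>

lemma Hreal_diff_le:
  assumes z: "z \<in> X"
  shows "Hreal (x k) - Hreal z \<le> \<gamma> / (real k + 4)"
proof (rule harmonic_decay[of "\<lambda>k. Hreal (x k) - Hreal z"])
  have gap: "Hreal (x n) - Hreal z \<le> Sgap N B A F g (x n)" for n
    using Hreal_diff_le_sum_bgap[OF x_in_X z] sum_bgap_le_Sgap[OF z] by (rule order_trans)
  show "Hreal (x 0) - Hreal z \<le> \<gamma> / 4"
    using gap Sgap_le_start by (rule order_trans)
  show "Hreal (x (Suc n)) - Hreal z \<le> Hreal (x n) - Hreal z" for n
    using sum_decr_le[of n] sum_decr_nonneg[of n] by linarith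
  \<comment> \<open>Since \<open>z\<close> need not be optimal, the difference can be negative; the
    gap inequality is squared only where it is not.\<close>
  show "(Hreal (x n) - Hreal z)\<^sup>2 \<le> \<gamma> * (Hreal (x n) - Hreal z - (Hreal (x (Suc n)) - Hreal z))"
    if "0 \<le> Hreal (x n) - Hreal z" for n
    using power_mono[OF gap that, of 2] Sgap_sq_le[of n] by simp
qed (rule \<gamma>_nonneg)

text \<open>The lower bound \<open>?r\<close> holds at every point, on \<open>X\<close> by
  \<open>Hreal_diff_le\<close> and trivially outside, hence passes to the infimum.\<close>

lemma Hobj_rate: "Hobj N B A F g (x k) - Hstar N B A F g \<le> ereal (\<gamma> / (real k + 4))"
proof -
  let ?r = "Hreal (x k) - \<gamma> / (real k + 4)"
  have "ereal ?r \<le> Hobj N B A F g z" for z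
  proof (cases "z \<in> X")
    case True
    then show ?thesis using Hreal_diff_le[OF True, of k] by (simp add: Hobj_eq)
  qed (simp add: Hobj_outside)
  then have "ereal ?r \<le> Hstar N B A F g"
    unfolding Hstar_def by (intro INF_greatest)
  then have "ereal (Hreal (x k)) - Hstar N B A F g \<le> ereal (Hreal (x k)) - ereal ?r"
    by (intro ereal_minus_mono order_refl)
  then show ?thesis by (simp add: Hobj_eq x_in_X)
qed

lemma Sgap_rate: "(MIN n\<in>{0..k}. Sgap N B A F g (x n)) \<le> 2 * \<gamma> / (real k + 4)"
  by (rule harmonic_decay_min[where H = "\<lambda>n. Hreal (x n)"])
    (intro Sgap_le_start Sgap_nonneg Sgap_sq_le Hreal_diff_le x_in_X \<gamma>_nonneg)+

end

theorem theorem4p13: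
  fixes N :: nat
    and B :: "'d::finite \<Rightarrow> nat"
    and A :: "real ^ 'd ^ 'm::finite"
    and F :: "real ^ 'm \<Rightarrow> real"
    and g :: "nat \<Rightarrow> real ^ 'd \<Rightarrow> ereal"
    and l \<beta> :: "nat \<Rightarrow> real"
    and LF :: real
    and x :: "nat \<Rightarrow> real ^ 'd"
    and y p :: "nat \<Rightarrow> nat \<Rightarrow> real ^ 'd"
    and \<alpha> :: "nat \<Rightarrow> nat \<Rightarrow> real"
    and k :: nat
  assumes blocks: "range B \<subseteq> {1..N}"
    and g_proper: "\<And>i. i \<in> {1..N} \<Longrightarrow> eproper (block_space B i) (g i)"
    and g_closed: "\<And>i. i \<in> {1..N} \<Longrightarrow> eclosed (block_space B i) (g i)"
    and g_convex: "\<And>i. i \<in> {1..N} \<Longrightarrow> econvex (block_space B i) (g i)"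
    and X_compact: "\<And>i. i \<in> {1..N} \<Longrightarrow> compact (Xblk B g i)"
    and g_lipschitz: "\<And>i. i \<in> {1..N} \<Longrightarrow>
          (l i)-lipschitz_on (Xblk B g i) (\<lambda>v. real_of_ereal (g i v))"
    and F_convex: "convex_on ((\<lambda>z. A *v z) ` Xset N B g) F"
    and F_C1: "continuously_differentiable_over F ((\<lambda>z. A *v z) ` Xset N B g)"
    and F_lipschitz: "LF-lipschitz_on ((\<lambda>z. A *v z) ` Xset N B g) (grad F)"
    and \<beta>_pos: "\<And>i. i \<in> {1..N} \<Longrightarrow> \<beta> i > 0"
    and \<beta>_lipschitz: "\<And>i z h. i \<in> {1..N} \<Longrightarrow> z \<in> Xset N B g \<Longrightarrow> h \<in> block_space B i \<Longrightarrow>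
          z + Umat B i *v h \<in> Xset N B g \<Longrightarrow>
          norm (grad F (A *v z + block_mat B A i *v h) - grad F (A *v z))
            \<le> \<beta> i * norm (block_mat B A i *v h)"
    and cbcg: "cbcg_method N B A F g x y p \<alpha>"
    and adaptive: "adaptive_stepsize N B A F g \<beta> x y p \<alpha>"
  shows "Hobj N B A F g (x k) - Hstar N B A F g
           \<le> ereal (real N * C2const N B A F g l LF \<beta> / (real k + 4))
       \<and> (MIN n\<in>{0..k}. Sgap N B A F g (x n))
           \<le> 2 * real N * C2const N B A F g l LF \<beta> / (real k + 4)"
proof -
  interpret cbcg_run N B A F g l \<beta> LF x y p \<alpha>
    by unfold_locales (fact assms)+
  show ?thesis
    using Hobj_rate[of k] Sgap_rate[of k] by (simp add: \<gamma>_def mult.assoc)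
qed

end
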